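(* Let $H$ be a finite dimensional Hilbert space and $A\subset B(H)$ an operator system. Let $\mathcal K$ be a symmetric mapping cone on $B(H)$, and let $\phi\colon A\to B(H)$ be a positive map. Then $\phi$ is $\mathcal K$-positive if and only if $\phi$ is the restriction to $A$ of a map in $\mathcal K$.
   Context: $H$ is a finite dimensional complex Hilbert space, $t$ (also written $x\mapsto x^t$) is the transpose map on $B(H)$ with respect to a fixed orthonormal basis of $H$, and $Tr$ is the usual trace on $B(H)$. $P(H)$ is the set of positive linear maps of $B(H)$ into itself and $CP(H)\subset P(H)$ the set of completely positive ones. Cones are understood to be convex. A mapping cone (on $B(H)$) is a closed subcone $\mathcal K$ of $P(H)$ such that if $\phi\in\mathcal K$ and $\alpha,\beta\in CP(H)$, then $\alpha\circ\phi\in\mathcal K$ and $\phi\circ\beta\in\mathcal K$. For $\phi\in P(H)$, $\phi^*$ is the adjoint map in the Hilbert-Schmidt structure, i.e. $Tr(\phi(a)b)=Tr(a\phi^*(b))$ for all $a,b\in B(H)$, and $\phi^t=t\circ\phi\circ t$. A mapping cone $\mathcal K$ is symmetric if $\phi\in\mathcal K$ iff $\phi^*\in\mathcal K$ iff $\phi^t\in\mathcal K$. An operator system is a closed self-adjoint linear subspace of the bounded operators on a Hilbert space; here $A$ is such a subspace of $B(H)$. A linear map $\phi\colon A\to B(H)$ is positive if it maps positive operators in $A$ to positive operators. With $\iota$ the identity map, put $P(A,\mathcal K)=\{x\in A\otimes B(H): (\iota\otimes\alpha)(x)\ge 0\ \ \forall\,\alpha\in\mathcal K\}$, where positivity is that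 of operators in $B(H)\otimes B(H)=B(H\otimes H)$. For a linear map $\phi\colon A\to B(H)$ let $\tilde\phi$ be the linear functional on $A\otimes B(H)$ defined by $\tilde\phi(a\otimes b)=Tr(\phi(a)b^t)$. The map $\phi$ is called $\mathcal K$-positive if $\tilde\phi$ is positive on $P(A,\mathcal K)$, i.e. $\tilde\phi(x)\ge 0$ for all $x\in P(A,\mathcal K)$.
   Formalization: The operator system A is required to contain the identity operator, as is standard; for merely closed self-adjoint subspaces the claim is false (e.g. A spanned by diag(1,-1), φ(c·diag(1,-1)) = ic·1, K all positive maps). *)

theory Defs
  imports "HOL-Analysis.Analysis"
begin

text \<open>
  The Hilbert space \<open>H\<close> with its fixed orthonormal basis is \<open>complex ^ 'n\<close> with the standard basis,
  \<open>B(H)\<close> is \<open>complex ^ 'n ^ 'n\<close>, and \<open>B(H \<otimes> H)\<close> is the matrices indexed by \<open>'n \<times> 'n\<close>.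
  Transpose and trace are the library's. The library has no complex scalar multiplication on
  matrices and no complex inner product.
\<close>

definition cscale :: "complex \<Rightarrow> complex ^ 'n ^ 'm \<Rightarrow> complex ^ 'n ^ 'm"
  where "cscale c a = (\<chi> i j. c * a $ i $ j)"

lemma cscale_nth: "cscale c a $ i $ j = c * a $ i $ j"
  by (simp add: cscale_def)

global_interpretation cmat: vector_space "cscale :: complex \<Rightarrow> complex ^ 'n ^ 'm \<Rightarrow> _"
  by unfold_locales (simp_all add: cscale_def vec_eq_iff algebra_simps)

definition cinner :: "complex ^ 'n \<Rightarrow> complex ^ 'n \<Rightarrow> complex"
  where "cinner v w = (\<Sum>i\<in>UNIV. v $ i * cnj (w $ i))"

definition hadjoint :: "complex ^ 'n ^ 'n \<Rightarrow> complex ^ 'n ^ 'n"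
  where "hadjoint a = (\<chi> i j. cnj (a $ j $ i))"

lemma hadjoint_cinner: "cinner (a *v v) w = cinner v (hadjoint a *v w)"
proof -
  have "cinner (a *v v) w = (\<Sum>i\<in>UNIV. \<Sum>j\<in>UNIV. a $ i $ j * v $ j * cnj (w $ i))"
    by (simp add: cinner_def matrix_vector_mult_def sum_distrib_right)
  also have "\<dots> = (\<Sum>j\<in>UNIV. \<Sum>i\<in>UNIV. a $ i $ j * v $ j * cnj (w $ i))"
    by (rule sum.swap)
  also have "\<dots> = cinner v (hadjoint a *v w)"
    by (simp add: cinner_def matrix_vector_mult_def hadjoint_def sum_distrib_left mult_ac)
  finally show ?thesis .
qed

definition positive_op :: "complex ^ 'n ^ 'n \<Rightarrow> bool"
  where "positive_op a \<longleftrightarrow> (\<forall>v. cinner (a *v v) v \<in> \<real>\<^sub>\<ge>\<^sub>0)"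


subsection \<open>Positive and completely positive maps, mapping cones\<close>

definition pos_maps :: "(complex ^ 'n ^ 'n \<Rightarrow> complex ^ 'n ^ 'n) set"
  where "pos_maps = {\<phi>. Vector_Spaces.linear cscale cscale \<phi> \<and>
    (\<forall>a. positive_op a \<longrightarrow> positive_op (\<phi> a))}"

text \<open>
  A \<open>k \<times> k\<close> matrix with entries in \<open>B(H)\<close> is the function \<open>X\<close> restricted to indices below \<open>k\<close>;
  the quadratic form is that of the operator it defines on the direct sum of \<open>k\<close> copies of \<open>H\<close>.
\<close>

definition positive_block :: "nat \<Rightarrow> (nat \<Rightarrow> nat \<Rightarrow> complex ^ 'n ^ 'n) \<Rightarrow> bool"
  where "positive_block k X \<longleftrightarrow>
    (\<forall>v. (\<Sum>i<k. cinner (\<Sum>j<k. X i j *v v j) (v i)) \<in> \<real>\<^sub>\<ge>\<^sub>0)"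

definition cp_maps :: "(complex ^ 'n ^ 'n \<Rightarrow> complex ^ 'n ^ 'n) set"
  where "cp_maps = {\<phi>. Vector_Spaces.linear cscale cscale \<phi> \<and>
    (\<forall>k X. positive_block k X \<longrightarrow> positive_block k (\<lambda>i j. \<phi> (X i j)))}"

text \<open>
  Closedness below refers to the topology of pointwise convergence on functions, which on the linear
  maps of the finite-dimensional space \<open>B(H)\<close> is the norm topology.
\<close>

definition mapping_cone :: "(complex ^ 'n ^ 'n \<Rightarrow> complex ^ 'n ^ 'n) set \<Rightarrow> bool"
  where "mapping_cone K \<longleftrightarrow>
    K \<subseteq> pos_maps \<and> closed K \<and> K \<noteq> {} \<and>
    (\<forall>\<phi>\<in>K. \<forall>\<psi>\<in>K. (\<lambda>a. \<phi> a + \<psi> a) \<in> K) \<and>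
    (\<forall>\<phi>\<in>K. \<forall>c\<ge>0. (\<lambda>a. c *\<^sub>R \<phi> a) \<in> K) \<and>
    (\<forall>\<phi>\<in>K. \<forall>\<alpha>\<in>cp_maps. \<alpha> \<circ> \<phi> \<in> K) \<and>
    (\<forall>\<phi>\<in>K. \<forall>\<beta>\<in>cp_maps. \<phi> \<circ> \<beta> \<in> K)"

definition adj_map ::
    "(complex ^ 'n ^ 'n \<Rightarrow> complex ^ 'n ^ 'n) \<Rightarrow> (complex ^ 'n ^ 'n \<Rightarrow> complex ^ 'n ^ 'n)"
  where "adj_map \<phi> = (THE \<psi>. \<forall>a b. trace (\<phi> a ** b) = trace (a ** \<psi> b))"

definition transp_map ::
    "(complex ^ 'n ^ 'n \<Rightarrow> complex ^ 'n ^ 'n) \<Rightarrow> (complex ^ 'n ^ 'n \<Rightarrow> complex ^ 'n ^ 'n)"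
  where "transp_map \<phi> = transpose \<circ> \<phi> \<circ> transpose"

definition symmetric_cone :: "(complex ^ 'n ^ 'n \<Rightarrow> complex ^ 'n ^ 'n) set \<Rightarrow> bool"
  where "symmetric_cone K \<longleftrightarrow>
    (\<forall>\<phi>\<in>pos_maps. (\<phi> \<in> K \<longleftrightarrow> adj_map \<phi> \<in> K) \<and> (\<phi> \<in> K \<longleftrightarrow> transp_map \<phi> \<in> K))"


subsection \<open>Operator systems and K-positivity\<close>

text \<open>
  As is standard, an operator system contains the identity operator. Without it the characterization
  of K-positive maps fails: if \<open>A\<close> is the span of \<open>diag(1, -1)\<close>, the only positive
  operator in \<open>A\<close> is \<open>0\<close>, so every linear map on \<open>A\<close> is positive, and it is K-positive
  for the cone of all positive maps, but it need not even preserve self-adjointness.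
\<close>

definition operator_system :: "(complex ^ 'n ^ 'n) set \<Rightarrow> bool"
  where "operator_system A \<longleftrightarrow>
    cmat.subspace A \<and> closed A \<and> (\<forall>a\<in>A. hadjoint a \<in> A) \<and> mat 1 \<in> A"

definition linear_on :: "('c \<Rightarrow> 'a \<Rightarrow> 'a) \<Rightarrow> ('c \<Rightarrow> 'b \<Rightarrow> 'b) \<Rightarrow>
    'a::plus set \<Rightarrow> ('a \<Rightarrow> 'b::plus) \<Rightarrow> bool"
  where "linear_on s1 s2 S f \<longleftrightarrow>
    (\<forall>x\<in>S. \<forall>y\<in>S. f (x + y) = f x + f y) \<and> (\<forall>c. \<forall>x\<in>S. f (s1 c x) = s2 c (f x))"

definition positive_map_on ::
    "(complex ^ 'n ^ 'n) set \<Rightarrow> (complex ^ 'n ^ 'n \<Rightarrow> complex ^ 'n ^ 'n) \<Rightarrow> bool"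
  where "positive_map_on A \<phi> \<longleftrightarrow>
    linear_on cscale cscale A \<phi> \<and> (\<forall>a\<in>A. positive_op a \<longrightarrow> positive_op (\<phi> a))"

definition kron ::
    "complex ^ 'n ^ 'n \<Rightarrow> complex ^ 'n ^ 'n \<Rightarrow> complex ^ ('n \<times> 'n) ^ ('n \<times> 'n)"
  where "kron a b = (\<chi> p q. a $ fst p $ fst q * b $ snd p $ snd q)"

definition tensor_space ::
    "(complex ^ 'n ^ 'n) set \<Rightarrow> (complex ^ ('n \<times> 'n) ^ ('n \<times> 'n)) set"
  where "tensor_space A = cmat.span {kron a b |a b. a \<in> A}"

definition id_tensor :: "(complex ^ 'n ^ 'n \<Rightarrow> complex ^ 'n ^ 'n) \<Rightarrow>
    (complex ^ ('n \<times> 'n) ^ ('n \<times> 'n) \<Rightarrow> complex ^ ('n \<times> 'n) ^ ('n \<times> 'n))"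
  where "id_tensor \<alpha> =
    (THE f. Vector_Spaces.linear cscale cscale f \<and> (\<forall>a b. f (kron a b) = kron a (\<alpha> b)))"

definition P_cone :: "(complex ^ 'n ^ 'n) set \<Rightarrow>
    (complex ^ 'n ^ 'n \<Rightarrow> complex ^ 'n ^ 'n) set \<Rightarrow> (complex ^ ('n \<times> 'n) ^ ('n \<times> 'n)) set"
  where "P_cone A K = {x \<in> tensor_space A. \<forall>\<alpha>\<in>K. positive_op (id_tensor \<alpha> x)}"

text \<open>
  The functional is determined on \<open>tensor_space A\<close> only (see \<open>tilde_eq\<close> below), hence the choice
  operator; its values elsewhere are arbitrary and never used.
\<close>

definition tilde :: "(complex ^ 'n ^ 'n) set \<Rightarrow> (complex ^ 'n ^ 'n \<Rightarrow> complex ^ 'n ^ 'n) \<Rightarrow>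
    (complex ^ ('n \<times> 'n) ^ ('n \<times> 'n) \<Rightarrow> complex)"
  where "tilde A \<phi> = (SOME f. linear_on cscale (*) (tensor_space A) f \<and>
    (\<forall>a\<in>A. \<forall>b. f (kron a b) = trace (\<phi> a ** transpose b)))"

definition K_positive :: "(complex ^ 'n ^ 'n) set \<Rightarrow>
    (complex ^ 'n ^ 'n \<Rightarrow> complex ^ 'n ^ 'n) set \<Rightarrow>
    (complex ^ 'n ^ 'n \<Rightarrow> complex ^ 'n ^ 'n) \<Rightarrow> bool"
  where "K_positive A K \<phi> \<longleftrightarrow> (\<forall>x\<in>P_cone A K. tilde A \<phi> x \<in> \<real>\<^sub>\<ge>\<^sub>0)"


subsection \<open>The objects defined by description exist\<close>

definition unit_mat :: "'n \<Rightarrow> 'n \<Rightarrow> complex ^ 'n ^ 'n"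
  where "unit_mat k l = (\<chi> i j. if i = k \<and> j = l then 1 else 0)"

definition slice1 :: "'n \<Rightarrow> 'n \<Rightarrow> complex ^ ('n \<times> 'n) ^ ('n \<times> 'n) \<Rightarrow> complex ^ 'n ^ 'n"
  where "slice1 k l x = (\<chi> i j. x $ (i, k) $ (j, l))"

definition slice2 :: "'n \<Rightarrow> 'n \<Rightarrow> complex ^ ('n \<times> 'n) ^ ('n \<times> 'n) \<Rightarrow> complex ^ 'n ^ 'n"
  where "slice2 i j x = (\<chi> k l. x $ (i, k) $ (j, l))"

lemma linear_cscaleI:
  assumes "\<And>x y. f (x + y) = f x + f y" and "\<And>c x. f (cscale c x) = cscale c (f x)"
  shows "Vector_Spaces.linear cscale cscale f"
  using assms by unfold_locales auto

lemma linear_cscaleD: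
  assumes "Vector_Spaces.linear cscale cscale f"
  shows "f (x + y) = f x + f y" and "f (cscale c x) = cscale c (f x)" and "f 0 = 0"
    and "f (sum g S) = (\<Sum>i\<in>S. f (g i))"
proof -
  interpret Vector_Spaces.linear cscale cscale f by fact
  show "f (x + y) = f x + f y" "f (cscale c x) = cscale c (f x)" "f 0 = 0"
    "f (sum g S) = (\<Sum>i\<in>S. f (g i))"
    by (simp_all add: add scale sum)
qed

lemma sum_delta2:
  fixes f :: "'a::finite \<Rightarrow> 'b::finite \<Rightarrow> complex"
  shows "(\<Sum>k\<in>UNIV. \<Sum>l\<in>UNIV. if i = k \<and> j = l then f k l else 0) = f i j"
proof -
  have "(\<Sum>k\<in>UNIV. \<Sum>l\<in>UNIV. if i = k \<and> j = l then f k l else 0)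
      = (\<Sum>k\<in>UNIV. if i = k then f k j else 0)"
    by (intro sum.cong refl) auto
  then show ?thesis by simp
qed

lemma mat_expand:
  fixes b :: "complex ^ 'n ^ 'n"
  shows "b = (\<Sum>k\<in>UNIV. \<Sum>l\<in>UNIV. cscale (b $ k $ l) (unit_mat k l))"
  by (simp add: vec_eq_iff cscale_def unit_mat_def if_distrib sum_delta2 cong: if_cong)

lemma linear_onD:
  assumes "linear_on s1 s2 S f"
  shows "x \<in> S \<Longrightarrow> y \<in> S \<Longrightarrow> f (x + y) = f x + f y"
    and "x \<in> S \<Longrightarrow> f (s1 c x) = s2 c (f x)"
  using assms by (simp_all add: linear_on_def)

lemma tensor_expand1:
  "x = (\<Sum>k\<in>UNIV. \<Sum>l\<in>UNIV. kron (slice1 k l x) (unit_mat k l))"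
  by (simp add: vec_eq_iff kron_def slice1_def unit_mat_def if_distrib sum_delta2 cong: if_cong)

lemma kron_in_tensor_space: "a \<in> A \<Longrightarrow> kron a b \<in> tensor_space A"
  unfolding tensor_space_def by (rule cmat.span_base) auto

lemma slice1_in:
  assumes A: "cmat.subspace A" and x: "x \<in> tensor_space A"
  shows "slice1 k l x \<in> A"
  using x unfolding tensor_space_def
proof (induction rule: cmat.span_induct_alt)
  case base
  have "slice1 k l 0 = 0" by (simp add: slice1_def vec_eq_iff)
  then show ?case using cmat.subspace_0[OF A] by simp
next
  case (step c y z)
  then obtain a b where y: "y = kron a b" "a \<in> A" by auto
  have "slice1 k l (cscale c y + z) = cscale (c * b $ k $ l) a + slice1 k l z"
    by (simp add: y slice1_def kron_def cscale_def vec_eq_iff)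
  then show ?case
    using step y by (simp add: A cmat.subspace_add cmat.subspace_scale)
qed

lemma tensor_space_UNIV: "tensor_space UNIV = UNIV"
proof -
  have "x \<in> tensor_space UNIV" for x :: "complex ^ ('n::finite \<times> 'n) ^ ('n \<times> 'n)"
    by (subst tensor_expand1, unfold tensor_space_def, intro cmat.span_sum cmat.span_base) auto
  then show ?thesis by auto
qed

lemma trace_mult_sum: "trace (a ** b) = (\<Sum>i\<in>UNIV. \<Sum>j\<in>UNIV. a $ i $ j * b $ j $ i)"
  by (simp add: trace_def matrix_matrix_mult_def)

lemma trace_unit: "trace (unit_mat k l ** a) = a $ l $ k"
proof -
  have "trace (unit_mat k l ** a) =
      (\<Sum>i\<in>UNIV. \<Sum>j\<in>UNIV. if k = i \<and> l = j then a $ j $ i else 0)"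
    unfolding trace_mult_sum by (intro sum.cong refl) (auto simp: unit_mat_def)
  then show ?thesis by (simp add: sum_delta2)
qed

lemma trace_ext:
  fixes a b :: "complex ^ 'n ^ 'n"
  assumes "\<And>c. trace (c ** a) = trace (c ** b)" shows "a = b"
proof -
  have "a $ l $ k = b $ l $ k" for k l
    using assms[of "unit_mat k l"] by (simp add: trace_unit)
  then show ?thesis by (simp add: vec_eq_iff)
qed

lemma adj_map_eqI:
  assumes "\<And>a b. trace (\<phi> a ** b) = trace (a ** \<psi> b)"
  shows "adj_map \<phi> = \<psi>"
  unfolding adj_map_def
proof (rule the_equality)
  show "\<forall>a b. trace (\<phi> a ** b) = trace (a ** \<psi> b)" using assms by blast
next
  fix \<psi>' assume "\<forall>a b. trace (\<phi> a ** b) = trace (a ** \<psi>' b)"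
  then have "\<psi>' b = \<psi> b" for b
    using assms by (intro trace_ext) metis
  then show "\<psi>' = \<psi>" by blast
qed

lemma adj_map_ex:
  fixes \<phi> :: "complex ^ 'n ^ 'n \<Rightarrow> complex ^ 'n ^ 'n"
  assumes "Vector_Spaces.linear cscale cscale \<phi>"
  shows "trace (\<phi> a ** b) = trace (a ** (\<chi> i j. trace (\<phi> (unit_mat j i) ** b)))"
proof -
  note [simp] = linear_cscaleD[OF assms]
  have [simp]: "trace (0 :: complex ^ 'n ^ 'n) = 0"
    by (simp add: trace_def)
  have tr_sum: "trace (sum g S ** b) = (\<Sum>i\<in>S. trace (g i ** b))" for g and S :: "'n set"
    by (induction S rule: infinite_finite_induct)
      (simp_all add: trace_mult_sum distrib_right sum.distrib)
  have tr_scale: "trace (cscale c d ** b) = c * trace (d ** b)" for c d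
    by (simp add: trace_mult_sum cscale_nth sum_distrib_left mult_ac)
  have "trace (\<phi> a ** b) =
      trace (\<phi> (\<Sum>k\<in>UNIV. \<Sum>l\<in>UNIV. cscale (a $ k $ l) (unit_mat k l)) ** b)"
    by (simp only: mat_expand[of a, symmetric])
  also have "\<dots> = (\<Sum>k\<in>UNIV. \<Sum>l\<in>UNIV. a $ k $ l * trace (\<phi> (unit_mat k l) ** b))"
    by (simp add: tr_sum tr_scale)
  finally show ?thesis by (simp add: trace_mult_sum[of a])
qed

lemma adj_map:
  assumes "Vector_Spaces.linear cscale cscale \<phi>"
  shows "trace (\<phi> a ** b) = trace (a ** adj_map \<phi> b)"
  unfolding adj_map_eqI[OF adj_map_ex[OF assms]] by (rule adj_map_ex[OF assms])

lemma id_tensor_eq: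
  assumes "Vector_Spaces.linear cscale cscale \<alpha>"
  shows "id_tensor \<alpha> = (\<lambda>x. \<chi> p q. \<alpha> (slice2 (fst p) (fst q) x) $ snd p $ snd q)"
    (is "_ = ?g")
  unfolding id_tensor_def
proof (rule the_equality, intro conjI allI)
  note [simp] = linear_cscaleD[OF assms]
  have [simp]: "slice2 i j (x + y) = slice2 i j x + slice2 i j y"
    "slice2 i j (cscale c x) = cscale c (slice2 i j x)"
    "slice2 i j (kron a b) = cscale (a $ i $ j) b" for i j x y c a b
    by (simp_all add: slice2_def cscale_def kron_def vec_eq_iff)
  show "Vector_Spaces.linear cscale cscale ?g"
    by (rule linear_cscaleI) (simp_all add: vec_eq_iff cscale_nth)
  show g: "?g (kron a b) = kron a (\<alpha> b)" for a b
    by (simp add: vec_eq_iff cscale_nth) (simp add: kron_def)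
next
  fix f
  assume f: "Vector_Spaces.linear cscale cscale f \<and> (\<forall>a b. f (kron a b) = kron a (\<alpha> b))"
  have "f x = ?g x" for x
  proof -
    note fl = linear_cscaleD[OF conjunct1[OF f]]
    note al = linear_cscaleD[OF assms]
    have "f x = (\<Sum>k\<in>UNIV. \<Sum>l\<in>UNIV. kron (slice1 k l x) (\<alpha> (unit_mat k l)))"
      by (subst tensor_expand1[of x]) (simp add: fl f)
    moreover have "slice2 i j x = (\<Sum>k\<in>UNIV. \<Sum>l\<in>UNIV. cscale (slice1 k l x $ i $ j) (unit_mat k l))"
      for i j
      by (subst mat_expand) (simp add: slice1_def slice2_def)
    ultimately show ?thesis
      by (simp only: al) (simp add: vec_eq_iff kron_def cscale_nth)
  qed
  then show "f = ?g" by blast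
qed

lemma tilde_eq:
  assumes A: "cmat.subspace A" and \<phi>: "linear_on cscale cscale A \<phi>"
  shows "x \<in> tensor_space A \<Longrightarrow> tilde A \<phi> x = (\<Sum>k\<in>UNIV. \<Sum>l\<in>UNIV. \<phi> (slice1 k l x) $ k $ l)"
    and "linear_on cscale (*) (tensor_space A) (tilde A \<phi>)"
    and "a \<in> A \<Longrightarrow> tilde A \<phi> (kron a b) = trace (\<phi> a ** transpose b)"
proof -
  let ?P = "\<lambda>f. linear_on cscale (*) (tensor_space A) f \<and>
    (\<forall>a\<in>A. \<forall>b. f (kron a b) = trace (\<phi> a ** transpose b))"
  let ?g = "\<lambda>x. \<Sum>k\<in>UNIV. \<Sum>l\<in>UNIV. \<phi> (slice1 k l x) $ k $ l"
  have add: "\<phi> (u + v) = \<phi> u + \<phi> v" if "u \<in> A" "v \<in> A" for u v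
    using \<phi> that by (auto simp: linear_on_def)
  have scale: "\<phi> (cscale c u) = cscale c (\<phi> u)" if "u \<in> A" for c u
    using \<phi> that by (auto simp: linear_on_def)
  have sl: "slice1 i j (x + y) = slice1 i j x + slice1 i j y"
    "slice1 i j (cscale c x) = cscale c (slice1 i j x)"
    "slice1 i j (kron a b) = cscale (b $ i $ j) a" for i j x y c a b
    by (simp_all add: slice1_def cscale_def kron_def vec_eq_iff)
  have g: "?P ?g"
    unfolding linear_on_def
    by (auto simp: sl add scale slice1_in[OF A] sum.distrib sum_distrib_left cscale_nth
        trace_mult_sum transpose_def mult_ac)
  then have P: "?P (tilde A \<phi>)"
    unfolding tilde_def by (rule someI[of ?P])
  then show "linear_on cscale (*) (tensor_space A) (tilde A \<phi>)"
    and "a \<in> A \<Longrightarrow> tilde A \<phi> (kron a b) = trace (\<phi> a ** transpose b)" by auto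
  have zero: "0 \<in> tensor_space A" unfolding tensor_space_def by (rule cmat.span_zero)
  have eq: "y \<in> tensor_space A \<and> f y = ?g y"
    if f: "?P f" and y: "y \<in> cmat.span {kron a b |a b. a \<in> A}" for f y
    using y
  proof (induction rule: cmat.span_induct_alt)
    case base
    show ?case
      using linear_onD(2)[OF conjunct1[OF f] zero, of 0]
        linear_onD(2)[OF conjunct1[OF g] zero, of 0] zero
      by simp
  next
    case (step c u v)
    obtain a b where ab: "u = kron a b" "a \<in> A" using step(1) by blast
    have u: "u \<in> tensor_space A" unfolding ab(1) using ab(2) by (rule kron_in_tensor_space)
    then have cu: "cscale c u \<in> tensor_space A"
      unfolding tensor_space_def by (rule cmat.span_scale)
    have v: "v \<in> tensor_space A" using step(2) by blast
    have cuv: "cscale c u + v \<in> tensor_space A"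
      using cu v unfolding tensor_space_def by (rule cmat.span_add)
    have "f (cscale c u + v) = c * f u + f v"
      using linear_onD[OF conjunct1[OF f]] u v cu by simp
    moreover have "?g (cscale c u + v) = c * ?g u + ?g v"
      by (simp only: linear_onD[OF conjunct1[OF g]] u v cu)
    moreover have "f u = ?g u"
      using conjunct2[OF f] conjunct2[OF g] ab by simp
    ultimately show ?case using step(2) cuv by simp
  qed
  show "x \<in> tensor_space A \<Longrightarrow> tilde A \<phi> x = ?g x"
    using eq[OF P] unfolding tensor_space_def by blast
qed

end

theory Submission
  imports Defs
begin

text \<open>
  Pairing an element \<open>x\<close> of \<open>A \<otimes> B(H)\<close> with a map \<open>\<psi>\<close> through \<open>tilde\<close>, the cone \<open>P(A, K)\<close> is the
  dual of \<open>K\<close>: testing \<open>(\<iota> \<otimes> \<alpha>)(x)\<close> on a vector of \<open>H \<otimes> H\<close> amounts to testing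
  \<open>(\<iota> \<otimes> Ad V \<circ> \<alpha>)(x)\<close> on the maximally entangled vector, which yields the pairing of \<open>x\<close> with
  the transposed adjoint of \<open>Ad V \<circ> \<alpha>\<close>, and \<open>K\<close> is stable under all these operations.
  The restrictions to \<open>A\<close> of the maps in \<open>K\<close> form a closed convex cone, since a positive map that
  vanishes at \<open>1 \<in> A\<close> vanishes. A map \<open>\<phi>\<close> outside this cone is therefore separated from it by some
  \<open>x\<close>, which can be made self-adjoint because positive maps preserve adjoints, and then \<open>x\<close> violates
  the \<open>K\<close>-positivity of \<open>\<phi>\<close>.
\<close>

section \<open>Closed cones\<close>

text \<open>The image is the cone over the images of the unit vectors of \<open>S\<close>. These
  form a compact set which misses 0 by \<open>inj\<close>, and the conic hull of such a set is
  closed.\<close>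

lemma closed_linear_image_conic:
  fixes f :: "'a::euclidean_space \<Rightarrow> 'b::euclidean_space"
  assumes f: "linear f" and S: "conic S" "closed S"
    and inj: "\<And>x. x \<in> S \<Longrightarrow> f x = 0 \<Longrightarrow> x = 0"
  shows "closed (f ` S)"
proof (cases "S = {}")
  case False
  let ?B = "S \<inter> sphere 0 1"
  have "compact (f ` ?B)"
    using S f by (intro compact_continuous_image linear_continuous_on)
      (auto simp: linear_conv_bounded_linear intro: closed_Int_compact)
  moreover have "0 \<notin> f ` ?B"
    using inj by fastforce
  \<comment> \<open>Adding 0 covers the case \<open>S = {0}\<close>, in which \<open>?B\<close> and
    its conic hull are empty.\<close>
  ultimately have "closed (insert 0 (conic hull (f ` ?B)))"
    by (intro closed_insert closed_conic_hull) auto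
  also have "insert 0 (conic hull (f ` ?B)) = f ` S"
  proof (intro equalityI subsetI)
    fix y assume "y \<in> insert 0 (conic hull (f ` ?B))"
    then consider "y = 0" | c x where "y = c *\<^sub>R f x" "c \<ge> 0" "x \<in> S"
      by (auto simp: conic_hull_explicit)
    then show "y \<in> f ` S"
    proof cases
      case 1
      obtain x where "x \<in> S" using False by blast
      then have "0 \<in> S" using S(1) conicD[of S x 0] by simp
      then show ?thesis using 1 linear_0[OF f] by (metis image_eqI)
    next
      case 2
      then show ?thesis
        using linear_scale[OF f] conicD[OF S(1)] by (metis image_eqI)
    qed
  next
    fix y assume "y \<in> f ` S"
    then obtain x where x: "x \<in> S" "y = f x" by blast
    show "y \<in> insert 0 (conic hull (f ` ?B))"
    proof (cases "x = 0")
      case True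
      then show ?thesis using x linear_0[OF f] by simp
    next
      case False
      then have "(1 / norm x) *\<^sub>R x \<in> ?B"
        using conicD[OF S(1) x(1), of "1 / norm x"] by simp
      moreover have "y = norm x *\<^sub>R f ((1 / norm x) *\<^sub>R x)"
        using False x by (simp add: linear_scale[OF f])
      ultimately show ?thesis
        unfolding conic_hull_explicit by (smt (verit) imageI insertCI mem_Collect_eq norm_ge_zero)
    qed
  qed
  finally show ?thesis .
qed simp

section \<open>Adjoints and positivity\<close>

lemma cinner_simps:
  "cinner (v + w) u = cinner v u + cinner w u"
  "cinner u (v + w) = cinner u v + cinner u w"
  "cinner (v - w) u = cinner v u - cinner w u"
  "cinner (- v) u = - cinner v u"
  "cinner (c *s v) u = c * cinner v u"
  "cinner u (c *s v) = cnj c * cinner u v"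
  by (simp_all add: cinner_def algebra_simps sum.distrib sum_subtractf sum_negf sum_distrib_left)

lemma cinner_commute: "cinner w v = cnj (cinner v w)"
  by (simp add: cinner_def mult.commute)

lemma cscale_mult_vec: "cscale c a *v v = c *s (a *v v)"
  by (simp add: vec_eq_iff matrix_vector_mult_def cscale_nth sum_distrib_left mult.assoc)

lemma hadjoint_simps [simp]:
  "hadjoint (hadjoint a) = a"
  "hadjoint (a + b) = hadjoint a + hadjoint b"
  "hadjoint (a - b) = hadjoint a - hadjoint b"
  "hadjoint (cscale c a) = cscale (cnj c) (hadjoint a)"
  "hadjoint (mat 1) = mat 1"
  by (auto simp: hadjoint_def cscale_def vec_eq_iff mat_def)

lemma cinner_axis:
  fixes a :: "complex ^ 'n ^ 'n"
  shows "cinner (a *v axis j 1) (axis i 1) = a $ i $ j"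
proof -
  have "cinner v (axis i 1) = v $ i" for v :: "complex ^ 'n"
    by (simp add: cinner_def axis_def if_distrib cong: if_cong)
  then show ?thesis
    by (simp add: matrix_vector_mult_def axis_def if_distrib cong: if_cong)
qed

text \<open>Polarization over the complex numbers: at the sum of the i-th basis vector and
  \<open>c\<close> times the j-th, the form reduces to
  \<open>c * a $ i $ j + cnj c * a $ j $ i\<close>. The choices \<open>c = 1\<close> and
  \<open>c = \<i>\<close> annihilate the sum and the difference of the two entries.\<close>

lemma quadratic_form_eq_0:
  assumes q: "\<And>v. cinner (a *v v) v = 0"
  shows "a = 0"
proof -
  have "a $ i $ j = 0" for i j
  proof -
    have sc: "a *v (c *s v) = c *s (a *v v)" for c v
      by (simp add: vector_scalar_commute)
    have "c * cinner (a *v axis j 1) (axis i 1) + cnj c * cinner (a *v axis i 1) (axis j 1) = 0" for c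
      using q[of "axis i 1 + c *s axis j 1"]
      by (simp add: cinner_simps matrix_vector_right_distrib sc q)
    from this[of 1] this[of \<i>] show ?thesis
      by (simp add: cinner_axis complex_eq_iff)
  qed
  then show ?thesis by (simp add: vec_eq_iff)
qed

lemma positive_op_hadjoint:
  assumes "positive_op a"
  shows "hadjoint a = a"
proof -
  have "cinner ((a - hadjoint a) *v v) v = 0" for v
  proof -
    have "cinner (hadjoint a *v v) v = cnj (cinner (a *v v) v)"
      by (metis hadjoint_cinner cinner_commute)
    moreover have "cinner (a *v v) v \<in> \<real>\<^sub>\<ge>\<^sub>0"
      using assms by (simp add: positive_op_def)
    ultimately show ?thesis
      by (simp add: matrix_vector_mult_diff_rdistrib cinner_simps complex_eq_iff
          complex_nonneg_Reals_iff)
  qed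
  then have "a - hadjoint a = 0" by (rule quadratic_form_eq_0)
  then show ?thesis by simp
qed

lemma hermitian_plus_scalar_positive:
  fixes h :: "complex ^ 'n ^ 'n"
  assumes h: "hadjoint h = h"
  obtains r :: real where "positive_op (cscale r (mat 1) + h)" "positive_op (cscale r (mat 1) - h)"
proof -
  \<comment> \<open>The sum of the moduli of all entries is a crude bound for the numerical radius
    of \<open>h\<close>.\<close>
  define r where "r = (\<Sum>i\<in>UNIV. \<Sum>j\<in>UNIV. norm (h $ i $ j))"
  have nn: "cinner v v = of_real ((norm v)\<^sup>2)" for v :: "complex ^ 'n"
    by (simp add: cinner_def norm_vec_def L2_set_def sum_nonneg complex_norm_square del: of_real_power)
  have im: "Im (cinner (h *v v) v) = 0" for v
    using cinner_commute[of "h *v v" v] hadjoint_cinner[of h v v] h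
    by (metis Reals_cnj_iff complex_is_Real_iff)
  have bd: "norm (cinner (h *v v) v) \<le> r * (norm v)\<^sup>2" for v
  proof -
    have "norm (cinner (h *v v) v) = norm (\<Sum>i\<in>UNIV. \<Sum>j\<in>UNIV. h $ i $ j * v $ j * cnj (v $ i))"
      by (simp add: cinner_def matrix_vector_mult_def sum_distrib_right)
    also have "\<dots> \<le> (\<Sum>i\<in>UNIV. \<Sum>j\<in>UNIV. norm (h $ i $ j) * (norm v)\<^sup>2)"
    proof (intro sum_norm_le)
      fix i j
      have "norm (v $ j) * norm (v $ i) \<le> norm v * norm v"
        by (intro mult_mono Finite_Cartesian_Product.norm_nth_le) auto
      then show "norm (h $ i $ j * v $ j * cnj (v $ i)) \<le> norm (h $ i $ j) * (norm v)\<^sup>2"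
        by (simp add: norm_mult mult.assoc power2_eq_square mult_left_mono)
    qed
    finally show ?thesis by (simp add: r_def sum_distrib_right)
  qed
  have q: "cinner (cscale r (mat 1) *v v) v = of_real (r * (norm v)\<^sup>2)" for v :: "complex ^ 'n"
    by (simp add: cscale_mult_vec cinner_simps nn)
  have re: "\<bar>Re (cinner (h *v v) v)\<bar> \<le> r * (norm v)\<^sup>2" for v
    using bd[of v] abs_Re_le_cmod order_trans by blast
  have pm: "0 \<le> r * (norm v)\<^sup>2 + Re (cinner (h *v v) v)"
    "0 \<le> r * (norm v)\<^sup>2 - Re (cinner (h *v v) v)" for v
    using re[of v] by linarith+
  have "positive_op (cscale r (mat 1) + h)" "positive_op (cscale r (mat 1) - h)"
    using im pm
    by (simp_all add: positive_op_def matrix_vector_mult_add_rdistrib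
        matrix_vector_mult_diff_rdistrib cinner_simps q complex_nonneg_Reals_iff)
  then show thesis by (rule that)
qed

text \<open>The explicit formulas for the two parts are exported so that both can be seen to lie in
  any operator system containing \<open>a\<close>.\<close>

lemma hermitian_decomp:
  obtains h k where "hadjoint h = h" "hadjoint k = k" "a = h + cscale \<i> k"
    "h = cscale (1/2) (a + hadjoint a)" "k = cscale (- \<i> / 2) (a - hadjoint a)"
proof (rule that[OF _ _ _ refl refl])
  have z: "z = 1 / 2 * (z + w) + \<i> * (- \<i> / 2 * (z - w))" for z w :: complex
    by (simp add: complex_eq_iff field_simps)
  show "a = cscale (1/2) (a + hadjoint a) + cscale \<i> (cscale (- \<i> / 2) (a - hadjoint a))"
    unfolding vec_eq_iff vector_add_component vector_minus_component cscale_nth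
    by (intro allI z)
  show "hadjoint (cscale (1/2) (a + hadjoint a)) = cscale (1/2) (a + hadjoint a)"
    by (simp add: add.commute)
  show "hadjoint (cscale (- \<i> / 2) (a - hadjoint a)) = cscale (- \<i> / 2) (a - hadjoint a)"
    by (simp add: vec_eq_iff cscale_nth algebra_simps del: cmat.scale_minus_left)
qed

section \<open>Positive maps\<close>

lemma operator_systemD:
  assumes "operator_system A"
  shows "cmat.subspace A" "mat 1 \<in> A" "a \<in> A \<Longrightarrow> hadjoint a \<in> A"
    "a \<in> A \<Longrightarrow> b \<in> A \<Longrightarrow> a + b \<in> A" "a \<in> A \<Longrightarrow> b \<in> A \<Longrightarrow> a - b \<in> A" "a \<in> A \<Longrightarrow> cscale c a \<in> A"
  using assms
  by (auto simp: operator_system_def cmat.subspace_add cmat.subspace_diff cmat.subspace_scale)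

text \<open>Since \<open>1 \<in> A\<close>, a self-adjoint \<open>h \<in> A\<close> is half the
  difference of the positive elements \<open>r 1 + h\<close> and \<open>r 1 - h\<close> of
  \<open>A\<close>, whose images are positive and hence self-adjoint. The Cartesian decomposition
  extends this to all of \<open>A\<close>.\<close>

lemma positive_map_on_hadjoint:
  assumes A: "operator_system A" and \<phi>: "positive_map_on A \<phi>" and a: "a \<in> A"
  shows "\<phi> (hadjoint a) = hadjoint (\<phi> a)"
proof -
  note A_in = operator_systemD[OF A]
  have add: "\<phi> (x + y) = \<phi> x + \<phi> y" and scale: "\<phi> (cscale c x) = cscale c (\<phi> x)"
    if "x \<in> A" "y \<in> A" for x y c
    using \<phi> that by (auto simp: positive_map_on_def linear_on_def)
  have herm: "hadjoint (\<phi> h) = \<phi> h" if h: "h \<in> A" "hadjoint h = h" for h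
  proof -
    obtain r :: real where r: "positive_op (cscale r (mat 1) + h)"
      "positive_op (cscale r (mat 1) - h)"
      using hermitian_plus_scalar_positive[OF h(2)] by blast
    let ?p = "cscale r (mat 1) + h" and ?m = "cscale r (mat 1) - h"
    have in_A: "?p \<in> A" "?m \<in> A" using h A_in by auto
    then have pos: "positive_op (\<phi> ?p)" "positive_op (\<phi> ?m)"
      using \<phi> r by (auto simp: positive_map_on_def)
    have "h = cscale (1/2) (?p + cscale (-1) ?m)"
      by (simp add: vec_eq_iff cscale_nth)
    then have "\<phi> h = cscale (1/2) (\<phi> ?p + cscale (-1) (\<phi> ?m))"
      using in_A A_in(4,6) by (metis add scale)
    then show ?thesis
      using pos[THEN positive_op_hadjoint] by simp
  qed
  obtain h k where hk: "hadjoint h = h" "hadjoint k = k" "a = h + cscale \<i> k"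
    and hk': "h = cscale (1/2) (a + hadjoint a)" "k = cscale (- \<i> / 2) (a - hadjoint a)"
    by (rule hermitian_decomp)
  have in_A: "h \<in> A" "k \<in> A" using a by (simp_all only: hk' A_in)
  have "\<phi> (hadjoint a) = \<phi> (h + cscale (- \<i>) k)"
    unfolding hk(3) by (simp add: hk(1,2) del: cmat.scale_minus_left)
  also have "\<dots> = hadjoint (\<phi> a)"
    unfolding hk(3) using in_A A_in(6) hk(1,2) by (simp add: add scale herm del: cmat.scale_minus_left)
  finally show ?thesis .
qed

lemma pos_maps_linear: "\<phi> \<in> pos_maps \<Longrightarrow> Vector_Spaces.linear cscale cscale \<phi>"
  by (simp add: pos_maps_def)

lemma pos_maps_positive_map_on: "\<phi> \<in> pos_maps \<Longrightarrow> positive_map_on A \<phi>"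
  by (auto simp: pos_maps_def positive_map_on_def linear_on_def linear_cscaleD)

text \<open>For self-adjoint \<open>h\<close>, both \<open>r 1 + h\<close> and
  \<open>r 1 - h\<close> are positive for some \<open>r\<close>. As the multiple of 1 is sent to 0,
  \<open>\<phi> h\<close> and its negative are both positive.\<close>

lemma pos_maps_eq_0:
  assumes \<phi>: "\<phi> \<in> pos_maps" and 1: "\<phi> (mat 1) = 0"
  shows "\<phi> a = 0"
proof -
  note lin = linear_cscaleD[OF pos_maps_linear[OF \<phi>]]
  have herm: "\<phi> h = 0" if h: "hadjoint h = h" for h
  proof -
    obtain r :: real where "positive_op (cscale r (mat 1) + h)"
      "positive_op (cscale r (mat 1) - h)"
      using hermitian_plus_scalar_positive[OF h] by blast
    then have "positive_op (\<phi> (cscale r (mat 1) + h))"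
      "positive_op (\<phi> (cscale r (mat 1) + cscale (-1) h))"
      using \<phi> by (auto simp: pos_maps_def)
    then have "positive_op (\<phi> h)" "positive_op (cscale (-1) (\<phi> h))"
      by (simp_all only: lin 1) simp_all
    then have "cinner (\<phi> h *v v) v \<in> \<real>\<^sub>\<ge>\<^sub>0" "cinner (cscale (-1) (\<phi> h) *v v) v \<in> \<real>\<^sub>\<ge>\<^sub>0" for v
      unfolding positive_op_def by blast+
    then have "cinner (\<phi> h *v v) v \<in> \<real>\<^sub>\<ge>\<^sub>0" "- cinner (\<phi> h *v v) v \<in> \<real>\<^sub>\<ge>\<^sub>0" for v
      unfolding cscale_mult_vec cinner_simps by simp_all
    then have "cinner (\<phi> h *v v) v = 0" for v
      by (auto simp: complex_nonneg_Reals_iff complex_eq_iff intro: antisym)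
    then show ?thesis by (rule quadratic_form_eq_0)
  qed
  obtain h k where "hadjoint h = h" "hadjoint k = k" "a = h + cscale \<i> k"
    by (rule hermitian_decomp)
  then show ?thesis by (simp add: lin herm)
qed

section \<open>The pairing of tensors with maps\<close>

text \<open>The formula for \<open>tilde\<close> from \<open>tilde_eq\<close>, freed from
  \<open>A\<close> and from the choice operator, so that maps on \<open>A\<close> and maps in
  \<open>K\<close> can be compared on the same tensor.\<close>

definition pairing ::
    "(complex ^ 'n ^ 'n \<Rightarrow> complex ^ 'n ^ 'n) \<Rightarrow> complex ^ ('n \<times> 'n) ^ ('n \<times> 'n) \<Rightarrow> complex"
  where "pairing \<psi> x = (\<Sum>k\<in>UNIV. \<Sum>l\<in>UNIV. \<psi> (slice1 k l x) $ k $ l)"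

lemma tensor_space_iff:
  assumes "cmat.subspace A"
  shows "x \<in> tensor_space A \<longleftrightarrow> (\<forall>k l. slice1 k l x \<in> A)"
proof
  assume "\<forall>k l. slice1 k l x \<in> A"
  then show "x \<in> tensor_space A"
    by (subst tensor_expand1, unfold tensor_space_def, intro cmat.span_sum cmat.span_base) auto
qed (use assms slice1_in in blast)

lemma slice1_simps:
  "slice1 k l (x + y) = slice1 k l x + slice1 k l y"
  "slice1 k l (hadjoint x) = hadjoint (slice1 l k x)"
  by (simp_all add: slice1_def hadjoint_def vec_eq_iff)

text \<open>Makes the pairing real on \<open>x + hadjoint x\<close>, which lets real-linear
  separation produce a tensor with real pairings.\<close>

lemma pairing_hadjoint:
  assumes A: "operator_system A" and \<phi>: "positive_map_on A \<phi>" and x: "x \<in> tensor_space A"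
  shows "pairing \<phi> (hadjoint x) = cnj (pairing \<phi> x)"
proof -
  have "\<phi> (slice1 k l (hadjoint x)) = hadjoint (\<phi> (slice1 l k x))" for k l
    using slice1_in[OF operator_systemD(1)[OF A] x]
    by (simp add: slice1_simps positive_map_on_hadjoint[OF A \<phi>])
  then have "pairing \<phi> (hadjoint x) = (\<Sum>k\<in>UNIV. \<Sum>l\<in>UNIV. cnj (\<phi> (slice1 l k x) $ l $ k))"
    by (simp add: pairing_def hadjoint_def)
  also have "\<dots> = cnj (pairing \<phi> x)"
    by (subst sum.swap) (simp add: pairing_def)
  finally show ?thesis .
qed

lemma pairing_add:
  assumes A: "cmat.subspace A" and \<phi>: "positive_map_on A \<phi>"
    and x: "x \<in> tensor_space A" and y: "y \<in> tensor_space A"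
  shows "pairing \<phi> (x + y) = pairing \<phi> x + pairing \<phi> y"
proof -
  have "\<phi> (slice1 k l (x + y)) = \<phi> (slice1 k l x) + \<phi> (slice1 k l y)" for k l
    using \<phi> slice1_in[OF A x] slice1_in[OF A y]
    by (auto simp: slice1_simps positive_map_on_def linear_on_def)
  then show ?thesis by (simp add: pairing_def sum.distrib)
qed

lemma sum_swap4:
  "(\<Sum>k\<in>A. \<Sum>l\<in>B. \<Sum>i\<in>C. \<Sum>j\<in>D. f k l i j) =
    (\<Sum>i\<in>C. \<Sum>j\<in>D. \<Sum>k\<in>A. \<Sum>l\<in>B. f k l i j)"
proof -
  have pair: "(\<Sum>k\<in>A. \<Sum>l\<in>B. h k l) = (\<Sum>p\<in>A \<times> B. h (fst p) (snd p))"
    "(\<Sum>i\<in>C. \<Sum>j\<in>D. g i j) = (\<Sum>p\<in>C \<times> D. g (fst p) (snd p))" for g h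
    by (simp_all add: sum.cartesian_product case_prod_unfold)
  show ?thesis unfolding pair by (rule sum.swap)
qed

lemma linear_expand_nth:
  assumes "Vector_Spaces.linear cscale cscale \<alpha>"
  shows "\<alpha> b $ i $ j = (\<Sum>k\<in>UNIV. \<Sum>l\<in>UNIV. b $ k $ l * \<alpha> (unit_mat k l) $ i $ j)"
  by (subst mat_expand[of b]) (simp add: linear_cscaleD[OF assms] cscale_nth)

text \<open>\<open>ent_form \<alpha> x\<close> is the quadratic form of \<open>(\<iota> \<otimes> \<alpha>)(x)\<close> at the maximally entangled vector.\<close>

definition ent_form ::
    "(complex ^ 'n ^ 'n \<Rightarrow> complex ^ 'n ^ 'n) \<Rightarrow> complex ^ ('n \<times> 'n) ^ ('n \<times> 'n) \<Rightarrow> complex"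
  where "ent_form \<alpha> x = (\<Sum>i\<in>UNIV. \<Sum>j\<in>UNIV. \<alpha> (slice2 i j x) $ i $ j)"

text \<open>In matrix units both sides are the same fourfold sum. The transposes remove the index
  flips that the trace puts into the adjoint.\<close>

lemma ent_form_eq_pairing:
  assumes "Vector_Spaces.linear cscale cscale \<alpha>"
  shows "ent_form \<alpha> x = pairing (transp_map (adj_map \<alpha>)) x"
proof -
  have "transp_map (adj_map \<alpha>) a $ k $ l
      = (\<Sum>i\<in>UNIV. \<Sum>j\<in>UNIV. a $ i $ j * \<alpha> (unit_mat k l) $ i $ j)" for a k l
    unfolding transp_map_def adj_map_eqI[OF adj_map_ex[OF assms]]
    by (simp add: transpose_def trace_mult_sum mult.commute)
  then have "pairing (transp_map (adj_map \<alpha>)) x = (\<Sum>k\<in>UNIV. \<Sum>l\<in>UNIV. \<Sum>i\<in>UNIV. \<Sum>j\<in>UNIV.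
      x $ (i, k) $ (j, l) * \<alpha> (unit_mat k l) $ i $ j)"
    by (simp add: pairing_def slice1_def)
  also have "\<dots> = (\<Sum>i\<in>UNIV. \<Sum>j\<in>UNIV. \<Sum>k\<in>UNIV. \<Sum>l\<in>UNIV.
      x $ (i, k) $ (j, l) * \<alpha> (unit_mat k l) $ i $ j)"
    by (rule sum_swap4)
  also have "\<dots> = ent_form \<alpha> x"
    unfolding ent_form_def by (subst linear_expand_nth[OF assms]) (simp add: slice2_def)
  finally show ?thesis by simp
qed

section \<open>Compressions by an operator \<open>V\<close> and quadratic forms at arbitrary
  vectors\<close>

definition conj_map :: "complex ^ 'n ^ 'n \<Rightarrow> complex ^ 'n ^ 'n \<Rightarrow> complex ^ 'n ^ 'n"
  where "conj_map V b = hadjoint V ** b ** V"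

lemma conj_map_one [simp]: "conj_map (mat 1) = id"
  by (simp add: conj_map_def fun_eq_iff)

lemma conj_map_nth:
  "conj_map V b $ i $ j = (\<Sum>k\<in>UNIV. \<Sum>l\<in>UNIV. b $ k $ l * V $ l $ j * cnj (V $ k $ i))"
proof -
  have "conj_map V b $ i $ j = (\<Sum>l\<in>UNIV. \<Sum>k\<in>UNIV. b $ k $ l * V $ l $ j * cnj (V $ k $ i))"
    by (simp add: conj_map_def matrix_matrix_mult_def hadjoint_def sum_distrib_left mult_ac)
  then show ?thesis by (subst sum.swap)
qed

text \<open>The form of the compressed block at the vectors \<open>v j\<close> is the form of the
  original block at \<open>V *v v j\<close>.\<close>

lemma conj_map_cp: "conj_map V \<in> cp_maps"
proof -
  have "Vector_Spaces.linear cscale cscale (conj_map V)"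
    by (rule linear_cscaleI)
      (simp_all add: vec_eq_iff conj_map_nth cscale_nth algebra_simps sum.distrib sum_distrib_left)
  moreover have "positive_block k (\<lambda>i j. conj_map V (X i j))" if X: "positive_block k X" for k X
    unfolding positive_block_def
  proof
    fix v :: "nat \<Rightarrow> complex ^ 'a"
    have "cinner (\<Sum>j<k. conj_map V (X i j) *v v j) (v i)
        = cinner (\<Sum>j<k. X i j *v (V *v v j)) (V *v v i)" for i
    proof -
      have "(\<Sum>j<k. conj_map V (X i j) *v v j) = hadjoint V *v (\<Sum>j<k. X i j *v (V *v v j))"
        by (simp add: conj_map_def linear_sum[OF matrix_vector_mul_linear] o_def matrix_vector_mul_assoc
            matrix_mul_assoc)
      then show ?thesis by (simp add: hadjoint_cinner)
    qed
    then show "(\<Sum>i<k. cinner (\<Sum>j<k. conj_map V (X i j) *v v j) (v i)) \<in> \<real>\<^sub>\<ge>\<^sub>0"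
      using X by (simp add: positive_block_def)
  qed
  ultimately show ?thesis by (simp add: cp_maps_def)
qed

text \<open>Every vector of \<open>H \<otimes> H\<close> is \<open>1 \<otimes> V\<close> applied to
  the maximally entangled vector, where \<open>V\<close> holds its coordinates. Moving
  \<open>1 \<otimes> V\<close> onto the operator compresses \<open>\<alpha>\<close> by
  \<open>V\<close>.\<close>

lemma cinner_id_tensor:
  assumes "Vector_Spaces.linear cscale cscale \<alpha>"
  shows "cinner (id_tensor \<alpha> x *v v) v = ent_form (conj_map (\<chi> l j. v $ (j, l)) \<circ> \<alpha>) x"
proof -
  let ?f = "\<lambda>i k j l. \<alpha> (slice2 i j x) $ k $ l * v $ (j, l) * cnj (v $ (i, k))"
  have "cinner (id_tensor \<alpha> x *v v) v = (\<Sum>(i, k)\<in>UNIV \<times> UNIV. \<Sum>(j, l)\<in>UNIV \<times> UNIV. ?f i k j l)"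
    by (simp add: cinner_def matrix_vector_mult_def id_tensor_eq[OF assms] sum_distrib_right
        case_prod_unfold)
  also have "\<dots> = (\<Sum>i\<in>UNIV. \<Sum>k\<in>UNIV. \<Sum>j\<in>UNIV. \<Sum>l\<in>UNIV. ?f i k j l)"
    by (simp only: sum.cartesian_product[symmetric])
  also have "\<dots> = (\<Sum>i\<in>UNIV. \<Sum>j\<in>UNIV. \<Sum>k\<in>UNIV. \<Sum>l\<in>UNIV. ?f i k j l)"
    by (intro sum.cong refl sum.swap)
  also have "\<dots> = ent_form (conj_map (\<chi> l j. v $ (j, l)) \<circ> \<alpha>) x"
    by (simp add: ent_form_def conj_map_nth)
  finally show ?thesis .
qed

section \<open>The dual description of the cone of tensors\<close>

lemma mapping_coneD:
  assumes "mapping_cone K"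
  shows "K \<subseteq> pos_maps" "closed K" "K \<noteq> {}"
    "\<phi> \<in> K \<Longrightarrow> \<psi> \<in> K \<Longrightarrow> (\<lambda>a. \<phi> a + \<psi> a) \<in> K"
    "\<phi> \<in> K \<Longrightarrow> 0 \<le> c \<Longrightarrow> (\<lambda>a. c *\<^sub>R \<phi> a) \<in> K"
    "\<phi> \<in> K \<Longrightarrow> \<alpha> \<in> cp_maps \<Longrightarrow> \<alpha> \<circ> \<phi> \<in> K"
  using assms by (auto simp: mapping_cone_def)

lemma positive_id_tensor_iff:
  assumes K: "mapping_cone K"
  shows "(\<forall>\<alpha>\<in>K. positive_op (id_tensor \<alpha> x)) \<longleftrightarrow> (\<forall>\<alpha>\<in>K. ent_form \<alpha> x \<in> \<real>\<^sub>\<ge>\<^sub>0)"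
proof (intro iffI ballI)
  fix \<alpha> assume \<alpha>: "\<alpha> \<in> K" and pos: "\<forall>\<alpha>\<in>K. positive_op (id_tensor \<alpha> x)"
  then have lin: "Vector_Spaces.linear cscale cscale \<alpha>"
    using mapping_coneD(1)[OF K] pos_maps_linear by blast
  \<comment> \<open>The maximally entangled vector, for which \<open>V\<close> is the
    identity.\<close>
  define v :: "complex ^ ('a \<times> 'a)" where "v = (\<chi> p. mat 1 $ snd p $ fst p)"
  have "(\<chi> l j. v $ (j, l)) = (mat 1 :: complex ^ 'a ^ 'a)"
    by (simp add: v_def vec_eq_iff)
  then have "ent_form \<alpha> x = cinner (id_tensor \<alpha> x *v v) v"
    by (simp add: cinner_id_tensor[OF lin])
  then show "ent_form \<alpha> x \<in> \<real>\<^sub>\<ge>\<^sub>0"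
    using pos \<alpha> by (simp add: positive_op_def)
next
  fix \<alpha> assume \<alpha>: "\<alpha> \<in> K" and pos: "\<forall>\<alpha>\<in>K. ent_form \<alpha> x \<in> \<real>\<^sub>\<ge>\<^sub>0"
  then have lin: "Vector_Spaces.linear cscale cscale \<alpha>"
    using mapping_coneD(1)[OF K] pos_maps_linear by blast
  show "positive_op (id_tensor \<alpha> x)"
    unfolding positive_op_def cinner_id_tensor[OF lin]
    using pos mapping_coneD(6)[OF K \<alpha> conj_map_cp] by blast
qed

lemma adj_map_adj_map:
  assumes "Vector_Spaces.linear cscale cscale \<phi>"
  shows "adj_map (adj_map \<phi>) = \<phi>"
  by (rule adj_map_eqI) (metis adj_map[OF assms] trace_mul_sym)

text \<open>Both operations preserve \<open>K\<close> and are involutive on linear maps. This allows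
  a quantifier over \<open>K\<close> to be reindexed by the transposed adjoint.\<close>

lemma symmetric_cone_image:
  assumes K: "mapping_cone K" and sym: "symmetric_cone K"
  shows "(\<lambda>\<alpha>. transp_map (adj_map \<alpha>)) ` K = K"
proof -
  have pos: "K \<subseteq> pos_maps" by (rule mapping_coneD(1)[OF K])
  have closed: "adj_map \<alpha> \<in> K" "transp_map \<alpha> \<in> K" if "\<alpha> \<in> K" for \<alpha>
    using sym that pos by (auto simp: symmetric_cone_def)
  have "\<psi> = transp_map (adj_map (adj_map (transp_map \<psi>)))" if "\<psi> \<in> K" for \<psi>
  proof -
    have "Vector_Spaces.linear cscale cscale (transp_map \<psi>)"
      using closed that pos pos_maps_linear by blast
    then show ?thesis
      by (simp add: adj_map_adj_map) (simp add: transp_map_def fun_eq_iff)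
  qed
  then show ?thesis using closed by blast
qed

lemma P_cone_iff:
  assumes K: "mapping_cone K" and sym: "symmetric_cone K"
  shows "x \<in> P_cone A K \<longleftrightarrow> x \<in> tensor_space A \<and> (\<forall>\<psi>\<in>K. pairing \<psi> x \<in> \<real>\<^sub>\<ge>\<^sub>0)"
proof -
  have "(\<forall>\<alpha>\<in>K. ent_form \<alpha> x \<in> \<real>\<^sub>\<ge>\<^sub>0) \<longleftrightarrow> (\<forall>\<alpha>\<in>K. pairing (transp_map (adj_map \<alpha>)) x \<in> \<real>\<^sub>\<ge>\<^sub>0)"
    using mapping_coneD(1)[OF K] by (auto simp: ent_form_eq_pairing pos_maps_linear subset_iff)
  also have "\<dots> \<longleftrightarrow> (\<forall>\<psi>\<in>(\<lambda>\<alpha>. transp_map (adj_map \<alpha>)) ` K. pairing \<psi> x \<in> \<real>\<^sub>\<ge>\<^sub>0)"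
    by simp
  finally show ?thesis
    by (simp add: P_cone_def positive_id_tensor_iff[OF K] symmetric_cone_image[OF K sym])
qed

section \<open>Coordinates on the space of linear maps\<close>

text \<open>Linear maps are coded by their values on matrix units, which places them in a Euclidean
  space where convex separation applies.\<close>

definition of_coeffs :: "complex ^ 'n ^ 'n ^ 'n ^ 'n \<Rightarrow> complex ^ 'n ^ 'n \<Rightarrow> complex ^ 'n ^ 'n"
  where "of_coeffs c a = (\<Sum>k\<in>UNIV. \<Sum>l\<in>UNIV. cscale (a $ k $ l) (c $ k $ l))"

definition coeffs :: "(complex ^ 'n ^ 'n \<Rightarrow> complex ^ 'n ^ 'n) \<Rightarrow> complex ^ 'n ^ 'n ^ 'n ^ 'n"
  where "coeffs \<phi> = (\<chi> k l. \<phi> (unit_mat k l))"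

lemma of_coeffs_linear: "Vector_Spaces.linear cscale cscale (of_coeffs c)"
  by (rule linear_cscaleI)
    (simp_all add: of_coeffs_def vec_eq_iff cscale_nth algebra_simps sum.distrib sum_distrib_left)

lemma of_coeffs_add: "of_coeffs (c + d) a = of_coeffs c a + of_coeffs d a"
  and of_coeffs_scaleR: "of_coeffs (r *\<^sub>R c) a = r *\<^sub>R of_coeffs c a"
  by (simp_all add: of_coeffs_def vec_eq_iff cscale_nth algebra_simps sum.distrib scaleR_sum_right)

lemma of_coeffs_coeffs:
  assumes "Vector_Spaces.linear cscale cscale \<phi>"
  shows "of_coeffs (coeffs \<phi>) = \<phi>"
  by (rule ext, subst (2) mat_expand)
    (simp add: of_coeffs_def coeffs_def linear_cscaleD[OF assms])

lemma coeffs_of_coeffs: "coeffs (of_coeffs c) = c"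
  by (simp add: coeffs_def of_coeffs_def unit_mat_def vec_eq_iff cscale_nth if_distrib[of "\<lambda>z. z * _"]
      sum_delta2 eq_commute cong: if_cong)

text \<open>For the pointwise topology it suffices that each evaluation is linear in the
  coefficients. Closedness of \<open>K\<close> thus passes to its coordinates.\<close>

lemma continuous_of_coeffs: "continuous_on UNIV of_coeffs"
proof (rule continuous_on_coordinatewise_then_product)
  fix a
  have "linear (\<lambda>c. of_coeffs c a)"
    by (rule linearI) (simp_all add: of_coeffs_add of_coeffs_scaleR)
  then show "continuous_on UNIV (\<lambda>c. of_coeffs c a)"
    by (simp add: linear_continuous_on linear_conv_bounded_linear)
qed

text \<open>Every real-linear functional on the coefficients is the real part of the pairing with a
  tensor. The conjugate comes from the real inner product \<open>Re (cnj u * w)\<close> on the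
  complex numbers.\<close>

lemma inner_eq_pairing:
  "y \<bullet> c = Re (pairing (of_coeffs c) (\<chi> p q. cnj (y $ fst p $ fst q $ snd p $ snd q)))"
proof -
  have "y \<bullet> c = Re (\<Sum>k\<in>UNIV. \<Sum>l\<in>UNIV. \<Sum>i\<in>UNIV. \<Sum>j\<in>UNIV. cnj (y $ k $ l $ i $ j) * c $ k $ l $ i $ j)"
    by (simp add: inner_vec_def inner_complex_def)
  also have "\<dots> = Re (\<Sum>i\<in>UNIV. \<Sum>j\<in>UNIV. \<Sum>k\<in>UNIV. \<Sum>l\<in>UNIV. cnj (y $ k $ l $ i $ j) * c $ k $ l $ i $ j)"
    by (subst sum_swap4) simp
  finally show ?thesis
    by (simp add: pairing_def of_coeffs_def slice1_def cscale_nth)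
qed

text \<open>A left inverse of the inclusion of \<open>A\<close>, linear but with no positivity
  claimed. Composing with it codes a map on \<open>A\<close> as a map on all of
  \<open>B(H)\<close>.\<close>

lemma ex_projection:
  assumes "cmat.subspace A"
  obtains P where "Vector_Spaces.linear cscale cscale P" "range P \<subseteq> A" "\<And>a. a \<in> A \<Longrightarrow> P a = a"
proof -
  interpret p: vector_space_pair cscale cscale by unfold_locales
  have "Vector_Spaces.linear cscale cscale (\<lambda>a. a)" by (rule linear_cscaleI) auto
  from p.linear_exists_left_inverse_on[OF this assms] show thesis
    using that by auto
qed

section \<open>Restrictions to an operator system\<close>

text \<open>\<open>C\<close> is a linear image of the closed cone of coordinates of
  \<open>K\<close>. If \<open>\<psi> \<circ> P = 0\<close> with \<open>\<psi> \<in> K\<close>, then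
  \<open>\<psi>\<close> vanishes at \<open>P 1 = 1\<close> and so everywhere, which is the condition
  for the image to be closed.\<close>

lemma closed_restrictions:
  assumes K: "mapping_cone K" and P: "Vector_Spaces.linear cscale cscale P" "P (mat 1) = mat 1"
  defines "C \<equiv> (\<lambda>c. coeffs (of_coeffs c \<circ> P)) ` {c. of_coeffs c \<in> K}"
  shows "closed C" and "convex C" and "conic C"
proof -
  let ?S = "{c. of_coeffs c \<in> K}" and ?R = "\<lambda>c. coeffs (of_coeffs c \<circ> P)"
  have R: "linear ?R"
    by (rule linearI) (simp_all add: coeffs_def vec_eq_iff of_coeffs_add of_coeffs_scaleR)
  have add: "c + d \<in> ?S" if "c \<in> ?S" "d \<in> ?S" for c d
  proof -
    have "of_coeffs (c + d) = (\<lambda>a. of_coeffs c a + of_coeffs d a)"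
      by (rule ext) (rule of_coeffs_add)
    then show ?thesis using mapping_coneD(4)[OF K] that by simp
  qed
  have scale: "r *\<^sub>R c \<in> ?S" if "c \<in> ?S" "0 \<le> r" for r c
  proof -
    have "of_coeffs (r *\<^sub>R c) = (\<lambda>a. r *\<^sub>R of_coeffs c a)"
      by (rule ext) (rule of_coeffs_scaleR)
    then show ?thesis using mapping_coneD(5)[OF K] that by simp
  qed
  have conic: "conic ?S" using scale by (auto simp: conic_def)
  show "conic C" unfolding C_def using conic R by (rule conic_linear_image)
  have "convex ?S" unfolding convex_def using add scale by blast
  then show "convex C" unfolding C_def using R by (rule convex_linear_image[rotated])
  have "closed ?S"
    using closed_vimage[OF mapping_coneD(2)[OF K] continuous_of_coeffs] by (simp add: vimage_def)
  moreover have "c = 0" if c: "c \<in> ?S" "?R c = 0" for c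
  proof -
    have "of_coeffs c \<circ> P = of_coeffs (?R c)"
      by (intro of_coeffs_coeffs[symmetric] linear_cscaleI)
        (simp_all add: linear_cscaleD[OF P(1)] linear_cscaleD[OF of_coeffs_linear])
    then have "of_coeffs c (mat 1) = of_coeffs 0 (mat 1)"
      by (metis c(2) comp_apply P(2))
    then have "of_coeffs c (mat 1) = 0"
      by (simp add: of_coeffs_def vec_eq_iff cscale_nth)
    then have "of_coeffs c a = 0" for a
      using c(1) mapping_coneD(1)[OF K] pos_maps_eq_0 by blast
    then have "coeffs (of_coeffs c) = 0" by (simp add: coeffs_def vec_eq_iff)
    then show ?thesis by (simp add: coeffs_of_coeffs)
  qed
  ultimately show "closed C"
    unfolding C_def using R conic by (intro closed_linear_image_conic) auto
qed

lemma separating_tensor: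
  fixes A :: "(complex ^ 'n ^ 'n) set"
  assumes A: "operator_system A" and K: "mapping_cone K" and \<phi>: "positive_map_on A \<phi>"
    and not_restriction: "\<not> (\<exists>\<psi>\<in>K. \<forall>a\<in>A. \<phi> a = \<psi> a)"
  obtains x where "x \<in> tensor_space A" "Re (pairing \<phi> x) < 0"
    "\<And>\<psi>. \<psi> \<in> K \<Longrightarrow> 0 \<le> Re (pairing \<psi> x)"
proof -
  note sub = operator_systemD(1)[OF A]
  obtain P where P: "Vector_Spaces.linear cscale cscale P" "range P \<subseteq> A" "\<And>a. a \<in> A \<Longrightarrow> P a = a"
    using ex_projection[OF sub] by blast
  have lin_comp: "Vector_Spaces.linear cscale cscale (\<psi> \<circ> P)" if "linear_on cscale cscale A \<psi>" for \<psi>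
    using linear_onD[OF that] subsetD[OF P(2) rangeI]
    by (intro linear_cscaleI) (auto simp: linear_cscaleD[OF P(1)])
  define C where "C = (\<lambda>c. coeffs (of_coeffs c \<circ> P)) ` {c. of_coeffs c \<in> K}"
  have C: "closed C" "convex C" "conic C"
    unfolding C_def using K P(1) P(3)[OF operator_systemD(2)[OF A]] by (rule closed_restrictions)+
  have C_mem: "coeffs (\<psi> \<circ> P) \<in> C" if "\<psi> \<in> K" for \<psi>
  proof -
    have "of_coeffs (coeffs \<psi>) = \<psi>"
      using that mapping_coneD(1)[OF K] by (intro of_coeffs_coeffs pos_maps_linear) blast
    then show ?thesis unfolding C_def using that by (intro image_eqI[of _ _ "coeffs \<psi>"]) auto
  qed
  have \<phi>_lin: "linear_on cscale cscale A \<phi>" using \<phi> by (simp add: positive_map_on_def)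
  have K_lin: "linear_on cscale cscale A \<psi>" if "\<psi> \<in> K" for \<psi>
    using that mapping_coneD(1)[OF K] pos_maps_positive_map_on[of \<psi> A]
    by (auto simp: positive_map_on_def)
  \<comment> \<open>\<open>P\<close> fixes \<open>A\<close> pointwise, so membership would make
    \<open>\<phi>\<close> agree on \<open>A\<close> with a map in \<open>K\<close>.\<close>
  have "coeffs (\<phi> \<circ> P) \<notin> C"
  proof
    assume "coeffs (\<phi> \<circ> P) \<in> C"
    then obtain c where c: "of_coeffs c \<in> K" "coeffs (\<phi> \<circ> P) = coeffs (of_coeffs c \<circ> P)"
      by (auto simp: C_def)
    then have "\<phi> \<circ> P = of_coeffs c \<circ> P"
      using of_coeffs_coeffs[OF lin_comp] \<phi>_lin K_lin by metis
    then have "\<phi> a = of_coeffs c a" if "a \<in> A" for a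
      using P(3)[OF that] by (metis comp_apply)
    then show False using c(1) not_restriction by blast
  qed
  then obtain y b where y: "y \<bullet> coeffs (\<phi> \<circ> P) < b" "\<And>c. c \<in> C \<Longrightarrow> b < y \<bullet> c"
    using separating_hyperplane_closed_point[OF C(2,1)] by blast
  have "0 \<in> C"
    using C_mem mapping_coneD(3)[OF K] conicD[OF C(3), of _ 0] by fastforce
  then have b: "b < 0" using y(2) by fastforce
  have nonneg: "0 \<le> y \<bullet> c" if c: "c \<in> C" for c
  proof (rule ccontr)
    assume neg: "\<not> 0 \<le> y \<bullet> c"
    \<comment> \<open>Both \<open>b\<close> and \<open>y \<bullet> c\<close> are negative, so the
      rescaled point stays in the cone; its inner product with \<open>y\<close> is exactly
      \<open>b\<close>, against the strict inequality.\<close>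
    then have "b < y \<bullet> ((b / (y \<bullet> c)) *\<^sub>R c)"
      using b c by (intro y(2) conicD[OF C(3)]) (simp_all add: divide_nonpos_nonpos)
    then show False using neg by simp
  qed
  \<comment> \<open>\<open>z\<close> represents the functional \<open>y\<close>, and
    \<open>x\<close> is \<open>(P \<otimes> \<iota>)(z)\<close>. The slices of \<open>x\<close> lie
    in \<open>A\<close>, and pairing \<open>\<psi>\<close> with \<open>x\<close> is pairing
    \<open>\<psi> \<circ> P\<close> with \<open>z\<close>.\<close>
  define z :: "complex ^ ('n \<times> 'n) ^ ('n \<times> 'n)"
    where "z = (\<chi> p q. cnj (y $ fst p $ fst q $ snd p $ snd q))"
  define x :: "complex ^ ('n \<times> 'n) ^ ('n \<times> 'n)"
    where "x = (\<chi> p q. P (slice1 (snd p) (snd q) z) $ fst p $ fst q)"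
  have slice: "slice1 k l x = P (slice1 k l z)" for k l
    by (simp add: x_def slice1_def vec_eq_iff)
  have pair: "Re (pairing \<psi> x) = y \<bullet> coeffs (\<psi> \<circ> P)" if "linear_on cscale cscale A \<psi>" for \<psi>
    by (simp add: inner_eq_pairing of_coeffs_coeffs[OF lin_comp[OF that]] flip: z_def)
      (simp add: pairing_def slice)
  show thesis
  proof (rule that)
    show "x \<in> tensor_space A"
      using P(2) by (auto simp: tensor_space_iff[OF sub] slice)
    show "Re (pairing \<phi> x) < 0" using y(1) b by (simp add: pair[OF \<phi>_lin])
    show "0 \<le> Re (pairing \<psi> x)" if "\<psi> \<in> K" for \<psi>
      using nonneg C_mem that by (simp add: pair[OF K_lin])
  qed
qed

theorem theorem2:
  fixes A :: "(complex ^ 'n ^ 'n) set"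
    and K :: "(complex ^ 'n ^ 'n \<Rightarrow> complex ^ 'n ^ 'n) set"
    and \<phi> :: "complex ^ 'n ^ 'n \<Rightarrow> complex ^ 'n ^ 'n"
  assumes "operator_system A"
    and "mapping_cone K" and "symmetric_cone K"
    and "positive_map_on A \<phi>"
  shows "K_positive A K \<phi> \<longleftrightarrow> (\<exists>\<psi>\<in>K. \<forall>a\<in>A. \<phi> a = \<psi> a)"
proof -
  note sub = operator_systemD(1)[OF assms(1)]
  have "linear_on cscale cscale A \<phi>"
    using assms(4) by (simp add: positive_map_on_def)
  then have tilde: "tilde A \<phi> x = pairing \<phi> x" if "x \<in> tensor_space A" for x
    unfolding pairing_def using tilde_eq(1)[OF sub] that by blast
  show ?thesis
  proof
    assume "\<exists>\<psi>\<in>K. \<forall>a\<in>A. \<phi> a = \<psi> a"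
    then obtain \<psi> where \<psi>: "\<psi> \<in> K" "\<And>a. a \<in> A \<Longrightarrow> \<phi> a = \<psi> a" by blast
    \<comment> \<open>The slices of \<open>x\<close> lie in \<open>A\<close>, where
      \<open>\<phi>\<close> and \<open>\<psi>\<close> agree.\<close>
    have "tilde A \<phi> x = pairing \<psi> x" if "x \<in> tensor_space A" for x
      using that slice1_in[OF sub that] by (simp add: tilde pairing_def \<psi>(2))
    then show "K_positive A K \<phi>"
      using \<psi>(1) by (auto simp: K_positive_def P_cone_iff[OF assms(2,3)])
  next
    assume pos: "K_positive A K \<phi>"
    show "\<exists>\<psi>\<in>K. \<forall>a\<in>A. \<phi> a = \<psi> a"
    proof (rule ccontr)
      assume "\<not> ?thesis"
      then obtain x where x: "x \<in> tensor_space A" "Re (pairing \<phi> x) < 0"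
        "\<And>\<psi>. \<psi> \<in> K \<Longrightarrow> 0 \<le> Re (pairing \<psi> x)"
        using separating_tensor[OF assms(1,2,4)] by blast
      have adj: "hadjoint x \<in> tensor_space A"
        using x(1) operator_systemD(3)[OF assms(1)] by (simp add: tensor_space_iff[OF sub] slice1_simps)
      \<comment> \<open>Separation controls real parts only; adding the adjoint gives a pairing
        equal to twice the real part, so signs become genuine positivity.\<close>
      have sum: "pairing \<psi> (x + hadjoint x) = of_real (2 * Re (pairing \<psi> x))"
        if "positive_map_on A \<psi>" for \<psi>
        using that by (simp add: pairing_add[OF sub that x(1) adj]
            pairing_hadjoint[OF assms(1) that x(1)] complex_add_cnj)
      have in_A: "x + hadjoint x \<in> tensor_space A"
        using x(1) adj unfolding tensor_space_def by (rule cmat.span_add)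
      have "pairing \<psi> (x + hadjoint x) \<in> \<real>\<^sub>\<ge>\<^sub>0" if "\<psi> \<in> K" for \<psi>
        using that x(3) mapping_coneD(1)[OF assms(2)]
        by (subst sum) (auto simp: complex_nonneg_Reals_iff intro: pos_maps_positive_map_on)
      then have "x + hadjoint x \<in> P_cone A K"
        using in_A by (simp add: P_cone_iff[OF assms(2,3)])
      then have "tilde A \<phi> (x + hadjoint x) \<in> \<real>\<^sub>\<ge>\<^sub>0"
        using pos by (simp add: K_positive_def)
      then show False
        using x(2) by (simp add: tilde[OF in_A] sum[OF assms(4)] complex_nonneg_Reals_iff)
    qed
  qed
qed

end
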